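(* Let $\mathcal{F}$ be a family of analytic functions on $\mathbb{C}$. Let $D$ be the domain of normality of $\mathcal{F}$. Suppose $\mathcal{F}$ satisfies the following conditions on $D$: (1) for some point $\zeta\in D$ and some $L<\infty$, $|f(\zeta)|\leq L$ for all $f\in\mathcal{F}$; (2) for some fixed $\epsilon>0$, $|f'|\geq\epsilon$ on $D$ for all $f\in\mathcal{F}$. Then $D$ is contained in the domain of normality of the corresponding family of Schwarzian derivatives $\{S_f:f\in\mathcal{F}\}$.
   Context: A family of meromorphic functions (in particular, of analytic functions) is normal on an open set $U\subset\mathbb{C}$ if every sequence in the family has a subsequence converging locally uniformly on $U$ with respect to the spherical metric (the limit function $\infty$ being allowed). The domain of normality of a family of meromorphic functions on $\mathbb{C}$ is the largest open subset of $\mathbb{C}$ on which the family is normal. The Schwarzian derivative of $f$ is the meromorphic function $S_f(z)=\frac{f'''(z)}{f'(z)}-\frac{3}{2}\left(\frac{f''(z)}{f'(z)}\right)^2$.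
   Formalization: The domain of normality D is additionally assumed to be connected; for disconnected D the claim fails, since boundedness at ζ controls the family only on the component of D containing ζ. *)

theory Defs
  imports
    "HOL-Complex_Analysis.Complex_Analysis"
    "HOL-Library.Diagonal_Subsequence"
begin

text \<open>
  The Riemann sphere is \<^typ>\<open>complex option\<close>, with \<^term>\<open>None\<close> as the point at infinity
  (the convention of \<^const>\<open>Alexandroff_compactification\<close>). It is embedded into
  \<^typ>\<open>complex \<times> real\<close> as the unit sphere by stereographic projection, and the spherical
  metric is the great-circle distance there, i.e. the metric with element
  $2|dz|/(1+|z|^2)$.
\<close>

fun stereo :: "complex option \<Rightarrow> complex \<times> real" where
  "stereo None = (0, 1)"
| "stereo (Some z) =
     ((2 / (1 + (cmod z)\<^sup>2)) *\<^sub>R z, ((cmod z)\<^sup>2 - 1) / (1 + (cmod z)\<^sup>2))"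

definition spherical_dist :: "complex option \<Rightarrow> complex option \<Rightarrow> real" where
  "spherical_dist p q = arccos (stereo p \<bullet> stereo q)"

text \<open>
  A meromorphic function as a map into the Riemann sphere. In the library the value of
  a meromorphic function at an isolated singularity is arbitrary; poles are sent to infinity
  and removable singularities are filled in. Where \<open>f\<close> is analytic the value is \<^term>\<open>Some (f z)\<close>.
\<close>

definition to_sphere :: "(complex \<Rightarrow> complex) \<Rightarrow> complex \<Rightarrow> complex option" where
  "to_sphere f z = (if is_pole f z then None else Some (remove_sings f z))"

definition spherical_loc_uniform_limit ::
    "complex set \<Rightarrow> (nat \<Rightarrow> complex \<Rightarrow> complex option) \<Rightarrow> (complex \<Rightarrow> complex option) \<Rightarrow> bool" where
  "spherical_loc_uniform_limit U f g \<longleftrightarrow>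
     (\<forall>z\<in>U. \<exists>d>0. \<forall>e>0. \<forall>\<^sub>F n in sequentially. \<forall>w\<in>ball z d \<inter> U. spherical_dist (f n w) (g w) < e)"

text \<open>
  The limit is any sphere-valued function, so it may be infinite. On each component of an open
  \<open>U\<close> it is then automatically meromorphic or identically infinite (for meromorphic families).
\<close>

definition normal_family_on :: "(complex \<Rightarrow> complex) set \<Rightarrow> complex set \<Rightarrow> bool" where
  "normal_family_on F U \<longleftrightarrow>
     (\<forall>s. (\<forall>n::nat. s n \<in> F) \<longrightarrow>
        (\<exists>r g. strict_mono (r::nat \<Rightarrow> nat) \<and>
               spherical_loc_uniform_limit U (\<lambda>n. to_sphere (s (r n))) g))"

text \<open>
  Normality is a local property, so the union of all open sets of normality is itself
  the largest one; this is \<open>domain_of_normality_greatest\<close> below.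
\<close>

definition domain_of_normality :: "(complex \<Rightarrow> complex) set \<Rightarrow> complex set" where
  "domain_of_normality F = \<Union>{U. open U \<and> normal_family_on F U}"

definition schwarzian :: "(complex \<Rightarrow> complex) \<Rightarrow> complex \<Rightarrow> complex" where
  "schwarzian f z =
     (deriv ^^ 3) f z / deriv f z - 3 / 2 * ((deriv ^^ 2) f z / deriv f z)\<^sup>2"

lemma to_sphere_analytic:
  assumes "f analytic_on {z}"
  shows "to_sphere f z = Some (f z)"
  using assms analytic_at_imp_no_pole by (simp add: to_sphere_def)

lemma norm_stereo: "norm (stereo p) = 1"
proof (cases p)
  case None
  then show ?thesis by (simp add: norm_Pair)
next
  case (Some z)
  define t where "t = (cmod z)\<^sup>2"
  have t: "t \<ge> 0" by (simp add: t_def)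
  have "(norm (stereo p))\<^sup>2 = (2 / (1 + t))\<^sup>2 * t + ((t - 1) / (1 + t))\<^sup>2"
    by (simp add: Some norm_Pair power_mult_distrib t_def power_divide)
  also have "\<dots> = ((1 + t) / (1 + t))\<^sup>2"
    unfolding power_divide by (simp add: add_divide_distrib [symmetric] power2_eq_square algebra_simps)
  also have "\<dots> = 1" using t by simp
  finally show ?thesis by (simp add: power2_eq_1_iff) (smt (verit) norm_ge_zero)
qed

lemma inj_stereo: "inj stereo"
proof (rule injI)
  fix p q assume eq: "stereo p = stereo q"
  have snd: "snd (stereo (Some z)) = 1 - 2 / (1 + (cmod z)\<^sup>2)" for z
    using add_pos_nonneg[of 1 "(cmod z)\<^sup>2"] by (simp add: field_simps)
  have pos: "2 / (1 + (cmod z)\<^sup>2) > 0" for z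
    using add_pos_nonneg[of 1 "(cmod z)\<^sup>2"] by simp
  have snd_eq: "snd (stereo p) = snd (stereo q)" using eq by simp
  show "p = q"
  proof (cases p)
    case None
    show ?thesis
    proof (cases q)
      case (Some w)
      then show ?thesis using None snd_eq snd[of w] pos[of w] by (auto simp del: stereo.simps(2))
    qed (use None in simp)
  next
    case p: (Some z)
    show ?thesis
    proof (cases q)
      case None
      then show ?thesis using snd_eq snd[of z] pos[of z] p by (auto simp del: stereo.simps(2))
    next
      case q: (Some w)
      have c: "2 / (1 + (cmod z)\<^sup>2) = 2 / (1 + (cmod w)\<^sup>2)"
        using snd_eq snd[of z] snd[of w] p q by (auto simp del: stereo.simps(2))
      have "fst (stereo p) = fst (stereo q)" using eq by simp
      then have "(2 / (1 + (cmod z)\<^sup>2)) *\<^sub>R z = (2 / (1 + (cmod z)\<^sup>2)) *\<^sub>R w"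
        using p q c by simp
      then have "z = w" using pos[of z] by (metis less_irrefl scaleR_cancel_left)
      then show ?thesis using p q by simp
    qed
  qed
qed

lemma stereo_tendsto:
  assumes "(\<lambda>n. spherical_dist (a n) p) \<longlonglongrightarrow> 0"
  shows "(\<lambda>n. stereo (a n)) \<longlonglongrightarrow> stereo p"
proof -
  have "\<bar>stereo x \<bullet> stereo p\<bar> \<le> 1" for x
    using Cauchy_Schwarz_ineq2[of "stereo x" "stereo p"] by (simp add: norm_stereo)
  then have "cos (spherical_dist x p) = stereo x \<bullet> stereo p" for x
    by (simp add: spherical_dist_def abs_le_iff cos_arccos_abs)
  moreover have "(\<lambda>n. cos (spherical_dist (a n) p)) \<longlonglongrightarrow> cos 0"
    by (intro tendsto_intros assms)
  ultimately have "(\<lambda>n. stereo (a n) \<bullet> stereo p) \<longlonglongrightarrow> 1" by simp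
  then have "(\<lambda>n. sqrt (2 - 2 * (stereo (a n) \<bullet> stereo p))) \<longlonglongrightarrow> sqrt (2 - 2 * 1)"
    by (intro tendsto_intros)
  moreover have "dist (stereo x) (stereo p) = sqrt (2 - 2 * (stereo x \<bullet> stereo p))" for x
  proof -
    have "(dist (stereo x) (stereo p))\<^sup>2 = 2 - 2 * (stereo x \<bullet> stereo p)"
      using norm_stereo[of x] norm_stereo[of p]
      by (simp add: dist_norm power2_norm_eq_inner inner_diff inner_commute norm_eq_1)
    then show ?thesis by (metis real_sqrt_unique zero_le_dist)
  qed
  ultimately show ?thesis by (subst tendsto_dist_iff) simp
qed

lemma spherical_limit_pointwise:
  assumes "spherical_loc_uniform_limit U f g" "z \<in> U"
  shows "(\<lambda>n. stereo (f n z)) \<longlonglongrightarrow> stereo (g z)"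
proof (rule stereo_tendsto, rule tendstoI)
  fix e :: real assume "e > 0"
  obtain d where d: "d > 0"
    "\<And>e. e > 0 \<Longrightarrow> \<forall>\<^sub>F n in sequentially. \<forall>w\<in>ball z d \<inter> U. spherical_dist (f n w) (g w) < e"
    using assms unfolding spherical_loc_uniform_limit_def by blast
  have nonneg: "spherical_dist p q \<ge> 0" for p q
    unfolding spherical_dist_def
    using Cauchy_Schwarz_ineq2[of "stereo p" "stereo q"]
    by (intro arccos_lbound) (auto simp: norm_stereo abs_le_iff)
  show "\<forall>\<^sub>F n in sequentially. dist (spherical_dist (f n z) (g z)) 0 < e"
    using d(2)[OF \<open>e > 0\<close>] by eventually_elim (use assms(2) d(1) nonneg in auto)
qed

lemma spherical_limit_unique:
  assumes "spherical_loc_uniform_limit U f g" "spherical_loc_uniform_limit V f h" "z \<in> U" "z \<in> V"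
  shows "g z = h z"
proof -
  have "stereo (g z) = stereo (h z)"
    by (rule LIMSEQ_unique[OF spherical_limit_pointwise[OF assms(1,3)]
          spherical_limit_pointwise[OF assms(2,4)]])
  then show ?thesis using inj_stereo by (auto dest: injD)
qed

lemma spherical_limit_subseq:
  assumes "spherical_loc_uniform_limit U f g" "strict_mono r"
  shows "spherical_loc_uniform_limit U (\<lambda>n. f (r n)) g"
  unfolding spherical_loc_uniform_limit_def
proof
  fix z assume "z \<in> U"
  then obtain d where d: "d > 0"
    "\<And>e. e > 0 \<Longrightarrow> \<forall>\<^sub>F n in sequentially. \<forall>w\<in>ball z d \<inter> U. spherical_dist (f n w) (g w) < e"
    using assms unfolding spherical_loc_uniform_limit_def by blast
  show "\<exists>d>0. \<forall>e>0. \<forall>\<^sub>F n in sequentially. \<forall>w\<in>ball z d \<inter> U. spherical_dist (f (r n) w) (g w) < e"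
    using d(1) eventually_subseq[OF assms(2) d(2)] by blast
qed

lemma spherical_limit_shift:
  assumes "spherical_loc_uniform_limit U (\<lambda>n. f (k + n)) g"
  shows "spherical_loc_uniform_limit U f g"
proof -
  have shift: "(\<forall>\<^sub>F n in sequentially. P (k + n)) \<longleftrightarrow> eventually P sequentially" for P
    using eventually_sequentially_seg[of P k] by (simp add: add.commute)
  show ?thesis
    using assms unfolding spherical_loc_uniform_limit_def
    using shift[of "\<lambda>n. \<forall>w\<in>ball _ _ \<inter> U. spherical_dist (f n w) (g w) < _"] by simp
qed

lemma normal_family_on_domain: "normal_family_on F (domain_of_normality F)"
proof -
  let ?C = "{U. open U \<and> normal_family_on F U}"
  obtain C where C: "C \<subseteq> ?C" "countable C" "\<Union>C = \<Union>?C"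
    using Lindelof[of ?C] by auto
  define U where "U = from_nat_into (insert {} C)"
  have "range U = insert {} C"
    unfolding U_def using C(2) by (intro range_from_nat_into) auto
  moreover have "normal_family_on F {}"
    unfolding normal_family_on_def spherical_loc_uniform_limit_def
    by (auto intro: strict_mono_id)
  ultimately have U: "open (U i)" "normal_family_on F (U i)" for i
    using C(1) by (metis (mono_tags, lifting) insert_iff mem_Collect_eq open_empty rangeI subsetD)+
  have dom: "domain_of_normality F = (\<Union>i. U i)"
    unfolding domain_of_normality_def using \<open>range U = insert {} C\<close> C(3) by simp
  show ?thesis
    unfolding normal_family_on_def
  proof (intro allI impI)
    fix s :: "nat \<Rightarrow> complex \<Rightarrow> complex" assume s: "\<forall>n. s n \<in> F"
    define P where "P i r \<longleftrightarrow> (\<exists>g. spherical_loc_uniform_limit (U i) (\<lambda>n. to_sphere (s (r n))) g)"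
      for i and r :: "nat \<Rightarrow> nat"
    interpret subseqs P
    proof
      fix i and r :: "nat \<Rightarrow> nat"
      have "\<forall>n. (s \<circ> r) n \<in> F" using s by simp
      then show "\<exists>r'. strict_mono r' \<and> P i (r \<circ> r')"
        using U(2)[of i, unfolded normal_family_on_def, rule_format, of "s \<circ> r"]
        unfolding P_def o_def by blast
    qed
    have "P i (diagseq \<circ> (+) (Suc i))" for i
    proof (rule diagseq_holds)
      show "P n (t \<circ> r)" if "strict_mono r" "P n t" for r t n
        using that spherical_limit_subseq[where f = "\<lambda>n. to_sphere (s (t n))"]
        unfolding P_def o_def by blast
    qed
    then have "\<exists>g. spherical_loc_uniform_limit (U i) (\<lambda>n. to_sphere (s (diagseq (Suc i + n)))) g"
      for i
      using P_def[of i "diagseq \<circ> (+) (Suc i)"] by (simp add: o_def)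
    then have "\<exists>g. spherical_loc_uniform_limit (U i) (\<lambda>n. to_sphere (s (diagseq n))) g" for i
      using spherical_limit_shift[where f = "\<lambda>n. to_sphere (s (diagseq n))"] by blast
    then obtain G where G:
      "\<And>i. spherical_loc_uniform_limit (U i) (\<lambda>n. to_sphere (s (diagseq n))) (G i)"
      by metis
    define g where "g z = G (SOME i. z \<in> U i) z" for z
    have g: "g z = G i z" if "z \<in> U i" for i z
      unfolding g_def by (rule spherical_limit_unique[OF G G _ that]) (rule someI[of "\<lambda>i. z \<in> U i", OF that])
    have "spherical_loc_uniform_limit (domain_of_normality F) (\<lambda>n. to_sphere (s (diagseq n))) g"
      unfolding spherical_loc_uniform_limit_def
    proof
      fix z assume "z \<in> domain_of_normality F"
      then obtain i where i: "z \<in> U i" using dom by auto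
      obtain d where d: "d > 0" "\<And>e. e > 0 \<Longrightarrow> \<forall>\<^sub>F n in sequentially. \<forall>w\<in>ball z d \<inter> U i.
          spherical_dist (to_sphere (s (diagseq n)) w) (G i w) < e"
        using G[of i] i unfolding spherical_loc_uniform_limit_def by blast
      obtain d' where d': "d' > 0" "ball z d' \<subseteq> U i" using U(1) i open_contains_ball by blast
      show "\<exists>d>0. \<forall>e>0. \<forall>\<^sub>F n in sequentially. \<forall>w\<in>ball z d \<inter> domain_of_normality F.
          spherical_dist (to_sphere (s (diagseq n)) w) (g w) < e"
      proof (intro exI[of _ "min d d'"] conjI allI impI)
        fix e :: real assume "e > 0"
        show "\<forall>\<^sub>F n in sequentially. \<forall>w\<in>ball z (min d d') \<inter> domain_of_normality F.
          spherical_dist (to_sphere (s (diagseq n)) w) (g w) < e"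
          using d(2)[OF \<open>e > 0\<close>]
        proof eventually_elim
          case (elim n)
          show ?case
          proof
            fix w assume "w \<in> ball z (min d d') \<inter> domain_of_normality F"
            then have "w \<in> ball z d \<inter> U i" using d'(2) by auto
            then show "spherical_dist (to_sphere (s (diagseq n)) w) (g w) < e"
              using elim g[of w i] by auto
          qed
        qed
      qed (use d d' in auto)
    qed
    then show "\<exists>r g. strict_mono r \<and>
        spherical_loc_uniform_limit (domain_of_normality F) (\<lambda>n. to_sphere (s (r n))) g"
      using subseq_diagseq by blast
  qed
qed

lemma domain_of_normality_greatest:
  shows "open (domain_of_normality F)" "normal_family_on F (domain_of_normality F)"
    and "open U \<Longrightarrow> normal_family_on F U \<Longrightarrow> U \<subseteq> domain_of_normality F"
  using normal_family_on_domain by (auto simp: domain_of_normality_def)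

end

theory Submission
  imports Defs
begin

text \<open>
  Let \<open>g\<close> be the spherical limit on \<open>D\<close> of a sequence in \<open>F\<close>. By Hurwitz's theorem applied to the
  reciprocals, the set where \<open>g\<close> is infinite is open and closed in \<open>D\<close>; as it omits \<open>\<zeta>\<close>,
  it is empty. So the convergence is locally uniform in the Euclidean sense, and the Cauchy
  estimates carry it over to all derivatives. The first derivative of the limit still has modulus at least
  \<open>\<epsilon>\<close>, hence the Schwarzian derivatives converge locally uniformly as well.
\<close>

section \<open>Great-circle distance against chordal distance\<close>

lemma dist_stereo_power2: "(dist (stereo p) (stereo q))\<^sup>2 = 2 - 2 * (stereo p \<bullet> stereo q)"
  using norm_stereo[of p] norm_stereo[of q]
  by (simp add: dist_norm power2_norm_eq_inner inner_diff inner_commute norm_eq_1)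

lemma abs_inner_stereo_le: "\<bar>stereo p \<bullet> stereo q\<bar> \<le> 1"
  using Cauchy_Schwarz_ineq2[of "stereo p" "stereo q"] by (simp add: norm_stereo)

text \<open>A chord is no longer than its arc: an arc of length t on the unit sphere has chord 2
  sin(t/2), which is at most t.\<close>

lemma dist_stereo_le: "dist (stereo p) (stereo q) \<le> spherical_dist p q"
proof -
  define t where "t = spherical_dist p q"
  have ip: "-1 \<le> stereo p \<bullet> stereo q" "stereo p \<bullet> stereo q \<le> 1"
    using abs_inner_stereo_le[of p q] by auto
  have t: "t \<ge> 0" "cos t = stereo p \<bullet> stereo q"
    unfolding t_def spherical_dist_def using ip by (auto intro: arccos_lbound)
  have "(dist (stereo p) (stereo q))\<^sup>2 = 4 * (sin (t / 2))\<^sup>2"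
    using cos_double_sin[of "t / 2"] t(2) by (simp add: dist_stereo_power2)
  also have "\<dots> \<le> 4 * (t / 2)\<^sup>2"
    using abs_sin_x_le_abs_x[of "t / 2"] unfolding abs_le_square_iff by simp
  also have "\<dots> = t\<^sup>2" by (simp add: power2_eq_square)
  finally show ?thesis using t(1) unfolding t_def by (rule power2_le_imp_le)
qed

text \<open>The squared chord is 2 - 2 cos of the arc, so a chord shorter than that of an arc
  \<open>e'\<close> means a shorter arc, by monotonicity of \<open>arccos\<close>. With the previous
  bound this makes the two distances uniformly equivalent.\<close>

lemma spherical_dist_less_if_dist_stereo_less:
  assumes "e > 0"
  obtains d where "d > 0" "\<And>p q. dist (stereo p) (stereo q) < d \<Longrightarrow> spherical_dist p q < e"
proof -
  \<comment> \<open>The cap at \<open>pi\<close> keeps \<open>e'\<close> in the range where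
    \<open>arccos\<close> inverts \<open>cos\<close>.\<close>
  define e' where "e' = min e pi"
  have e': "0 < e'" "e' \<le> pi" "e' \<le> e" using assms by (auto simp: e'_def)
  have c: "cos e' < 1" using e' cos_monotone_0_pi[of 0 e'] by simp
  show thesis
  proof
    show "sqrt (2 - 2 * cos e') > 0" using c by simp
    fix p q assume "dist (stereo p) (stereo q) < sqrt (2 - 2 * cos e')"
    then have "(dist (stereo p) (stereo q))\<^sup>2 < (sqrt (2 - 2 * cos e'))\<^sup>2"
      by (intro power_strict_mono) auto
    then have "cos e' < stereo p \<bullet> stereo q" using c by (simp add: dist_stereo_power2)
    then have "spherical_dist p q < arccos (cos e')"
      unfolding spherical_dist_def using abs_inner_stereo_le[of p q]
      by (intro arccos_less_arccos) auto
    then show "spherical_dist p q < e" using e' by (simp add: arccos_cos)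
  qed
qed

text \<open>Uniformly equivalent distances have the same uniform limits. From here on, convergence
  on the sphere is uniform convergence of maps into \<open>complex \<times> real\<close>, where the
  usual limit rules apply.\<close>

lemma spherical_loc_uniform_limit_iff:
  "spherical_loc_uniform_limit U f g \<longleftrightarrow>
    (\<forall>z\<in>U. \<exists>d>0. uniform_limit (ball z d \<inter> U) (\<lambda>n w. stereo (f n w)) (\<lambda>w. stereo (g w)) sequentially)"
proof -
  have "(\<forall>e>0. \<forall>\<^sub>F n in sequentially. \<forall>w\<in>S. spherical_dist (f n w) (g w) < e) \<longleftrightarrow>
      (\<forall>e>0. \<forall>\<^sub>F n in sequentially. \<forall>w\<in>S. dist (stereo (f n w)) (stereo (g w)) < e)" for S
  proof (intro iffI allI impI)
    fix e :: real
    assume *: "\<forall>e>0. \<forall>\<^sub>F n in sequentially. \<forall>w\<in>S. spherical_dist (f n w) (g w) < e" and "e > 0"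
    then have "\<forall>\<^sub>F n in sequentially. \<forall>w\<in>S. spherical_dist (f n w) (g w) < e" by blast
    then show "\<forall>\<^sub>F n in sequentially. \<forall>w\<in>S. dist (stereo (f n w)) (stereo (g w)) < e"
      by eventually_elim (use dist_stereo_le le_less_trans in blast)
  next
    fix e :: real
    assume *: "\<forall>e>0. \<forall>\<^sub>F n in sequentially. \<forall>w\<in>S. dist (stereo (f n w)) (stereo (g w)) < e"
      and "e > 0"
    obtain d where d: "d > 0" "\<And>p q. dist (stereo p) (stereo q) < d \<Longrightarrow> spherical_dist p q < e"
      using spherical_dist_less_if_dist_stereo_less[OF \<open>e > 0\<close>] by blast
    then have "\<forall>\<^sub>F n in sequentially. \<forall>w\<in>S. dist (stereo (f n w)) (stereo (g w)) < d"
      using * by blast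
    then show "\<forall>\<^sub>F n in sequentially. \<forall>w\<in>S. spherical_dist (f n w) (g w) < e"
      by eventually_elim (use d(2) in blast)
  qed
  then show ?thesis
    unfolding spherical_loc_uniform_limit_def uniform_limit_iff by simp
qed

section \<open>The two charts of the sphere\<close>

lemma one_minus_snd_stereo_Some: "1 - snd (stereo (Some z)) = 2 / (1 + (cmod z)\<^sup>2)"
  using add_pos_nonneg[of 1 "(cmod z)\<^sup>2"] by (simp add: field_simps)

lemma one_plus_snd_stereo_Some: "1 + snd (stereo (Some z)) = 2 * (cmod z)\<^sup>2 / (1 + (cmod z)\<^sup>2)"
  using add_pos_nonneg[of 1 "(cmod z)\<^sup>2"] by (simp add: field_simps)

text \<open>This is projection from the north pole. It recovers the point by a quotient whose
  denominator vanishes only at infinity.\<close>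

lemma stereo_finite_chart:
  "fst (stereo (Some z)) / of_real (1 - snd (stereo (Some z))) = z"
proof -
  have "2 / (1 + (cmod z)\<^sup>2) \<noteq> 0" using add_pos_nonneg[of 1 "(cmod z)\<^sup>2"] by simp
  then show ?thesis
    unfolding one_minus_snd_stereo_Some by (simp add: scaleR_conv_of_real del: of_real_divide)
qed

text \<open>Projection from the south pole, followed by conjugation, is the coordinate 1/z near
  infinity. At \<open>z = 0\<close> both sides are 0 by the conventions for division by
  zero.\<close>

lemma stereo_infinite_chart:
  "cnj (fst (stereo (Some z))) / of_real (1 + snd (stereo (Some z))) = inverse z"
proof (cases "z = 0")
  case False
  define c where "c = 2 / (1 + (cmod z)\<^sup>2)"
  have c: "c \<noteq> 0" unfolding c_def using add_pos_nonneg[of 1 "(cmod z)\<^sup>2"] by simp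
  have "1 + snd (stereo (Some z)) = c * (cmod z)\<^sup>2"
    unfolding one_plus_snd_stereo_Some c_def by simp
  moreover have "fst (stereo (Some z)) = of_real c * z"
    by (simp add: c_def scaleR_conv_of_real)
  ultimately show ?thesis
    using c False by (simp add: field_simps del: stereo.simps flip: complex_norm_square)
qed simp

lemma snd_stereo_less_1_iff: "snd (stereo p) < 1 \<longleftrightarrow> p \<noteq> None"
proof (cases p)
  case (Some z)
  have "1 - snd (stereo (Some z)) > 0"
    unfolding one_minus_snd_stereo_Some using add_pos_nonneg[of 1 "(cmod z)\<^sup>2"] by simp
  then show ?thesis using Some by (simp del: stereo.simps)
qed simp

lemma cmod_fst_stereo_le: "cmod (fst (stereo p)) \<le> 1"
  using norm_fst_le[of "fst (stereo p)" "snd (stereo p)"] by (simp add: norm_stereo)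

section \<open>Spherical limits near finite and infinite values\<close>

lemma spherical_limit_stereo:
  assumes "open U" "spherical_loc_uniform_limit U (\<lambda>n w. Some (h n w)) g"
    and "\<And>n. continuous_on U (h n)" "z \<in> U"
  obtains d where "d > 0" "ball z d \<subseteq> U"
    "uniform_limit (ball z d) (\<lambda>n w. stereo (Some (h n w))) (\<lambda>w. stereo (g w)) sequentially"
    "continuous_on (ball z d) (\<lambda>w. stereo (g w))"
proof -
  obtain d1 where d1: "d1 > 0" "uniform_limit (ball z d1 \<inter> U)
      (\<lambda>n w. stereo (Some (h n w))) (\<lambda>w. stereo (g w)) sequentially"
    using assms(2,4) unfolding spherical_loc_uniform_limit_iff by blast
  obtain d2 where d2: "d2 > 0" "ball z d2 \<subseteq> U" using assms(1,4) open_contains_ball by blast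
  define d where "d = min d1 d2"
  have sub: "ball z d \<subseteq> ball z d1 \<inter> U" using d2 by (auto simp: d_def)
  have ul: "uniform_limit (ball z d) (\<lambda>n w. stereo (Some (h n w))) (\<lambda>w. stereo (g w)) sequentially"
    by (rule uniform_limit_on_subset[OF d1(2) sub])
  have "continuous_on (ball z d) (\<lambda>w. stereo (Some (h n w)))" for n
  proof -
    have "1 + (cmod (h n w))\<^sup>2 \<noteq> 0" for w
      using add_pos_nonneg[of 1 "(cmod (h n w))\<^sup>2"] by simp
    then show ?thesis
      using sub by (auto intro!: continuous_intros continuous_on_subset[OF assms(3)])
  qed
  then have "continuous_on (ball z d) (\<lambda>w. stereo (g w))"
    by (intro uniform_limit_theorem[OF _ ul]) auto
  then show thesis using that[of d] d1 d2 sub ul by (auto simp: d_def)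
qed

text \<open>By continuity of the limit, its height stays away from 1 near \<open>z\<close>. The
  denominator of the finite chart is then bounded below, the numerator has modulus at most 1, and
  division preserves the uniform limit.\<close>

lemma spherical_limit_finite:
  assumes "open U" "spherical_loc_uniform_limit U (\<lambda>n w. Some (h n w)) g"
    and "\<And>n. continuous_on U (h n)" "z \<in> U" "g z \<noteq> None"
  obtains d where "d > 0" "ball z d \<subseteq> U" "\<And>w. w \<in> ball z d \<Longrightarrow> g w \<noteq> None"
    "uniform_limit (ball z d) h (\<lambda>w. the (g w)) sequentially"
proof -
  obtain d1 where d1: "d1 > 0" "ball z d1 \<subseteq> U"
    "uniform_limit (ball z d1) (\<lambda>n w. stereo (Some (h n w))) (\<lambda>w. stereo (g w)) sequentially"
    "continuous_on (ball z d1) (\<lambda>w. stereo (g w))"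
    using spherical_limit_stereo[OF assms(1-4)] by blast
  \<comment> \<open>Half the denominator at \<open>z\<close>, so that the strict bound by
    \<open>t\<close> holds at \<open>z\<close> and persists on a small ball.\<close>
  define t where "t = (1 - snd (stereo (g z))) / 2"
  have t: "t > 0" using assms(5) snd_stereo_less_1_iff[of "g z"] by (simp add: t_def)
  have "open (ball z d1 \<inter> (\<lambda>w. 1 - snd (stereo (g w))) -` {t<..})"
    by (intro continuous_open_preimage continuous_intros d1) auto
  moreover have "z \<in> ball z d1 \<inter> (\<lambda>w. 1 - snd (stereo (g w))) -` {t<..}"
    using t d1(1) by (simp add: t_def)
  ultimately obtain d where d: "d > 0" "ball z d \<subseteq> ball z d1 \<inter> (\<lambda>w. 1 - snd (stereo (g w))) -` {t<..}"
    unfolding open_contains_ball by blast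
  have big: "t \<le> 1 - snd (stereo (g w))" if "w \<in> ball z d" for w
    using d(2) that by force
  have fin: "g w \<noteq> None" if "w \<in> ball z d" for w
    using big[OF that] t snd_stereo_less_1_iff[of "g w"] by simp
  have ul: "uniform_limit (ball z d) (\<lambda>n w. stereo (Some (h n w))) (\<lambda>w. stereo (g w)) sequentially"
    using uniform_limit_on_subset[OF d1(3)] d(2) by blast
  have "uniform_limit (ball z d)
      (\<lambda>n w. fst (stereo (Some (h n w))) / of_real (1 - snd (stereo (Some (h n w)))))
      (\<lambda>w. fst (stereo (g w)) / of_real (1 - snd (stereo (g w)))) sequentially"
  proof (rule uniform_lim_divide)
    show "bounded ((\<lambda>w. fst (stereo (g w))) ` ball z d)"
      using cmod_fst_stereo_le by (auto simp: bounded_iff)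
    show "t \<le> norm (of_real (1 - snd (stereo (g w))) :: complex)" if "w \<in> ball z d" for w
      using big[OF that] unfolding norm_of_real by linarith
  qed (use t in \<open>auto intro!: uniform_limit_intros ul simp del: stereo.simps of_real_diff\<close>)
  then have "uniform_limit (ball z d) h (\<lambda>w. fst (stereo (g w)) / of_real (1 - snd (stereo (g w))))
      sequentially"
    by (simp only: stereo_finite_chart)
  then have "uniform_limit (ball z d) h (\<lambda>w. the (g w)) sequentially"
  proof (rule uniform_limit_cong'[THEN iffD1, rotated -1])
    fix w assume "w \<in> ball z d"
    then show "fst (stereo (g w)) / of_real (1 - snd (stereo (g w))) = the (g w)"
      using fin stereo_finite_chart by (metis option.collapse)
  qed simp
  then show thesis using that[of d] d1(2) d fin by blast
qed

text \<open>In the chart at infinity the reciprocals converge uniformly to a holomorphic function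
  with a zero at \<open>z\<close>. Eventually they have no zeros themselves, so by Hurwitz's theorem
  the limit is constant, hence 0.\<close>

lemma spherical_limit_infinite:
  assumes "open U" "spherical_loc_uniform_limit U (\<lambda>n w. Some (h n w)) g"
    and "\<And>n. h n holomorphic_on U" "z \<in> U" "g z = None"
  obtains d where "d > 0" "ball z d \<subseteq> U" "\<And>w. w \<in> ball z d \<Longrightarrow> g w = None"
proof -
  have cont: "continuous_on U (h n)" for n
    by (rule holomorphic_on_imp_continuous_on[OF assms(3)])
  obtain d1 where d1: "d1 > 0" "ball z d1 \<subseteq> U"
    "uniform_limit (ball z d1) (\<lambda>n w. stereo (Some (h n w))) (\<lambda>w. stereo (g w)) sequentially"
    "continuous_on (ball z d1) (\<lambda>w. stereo (g w))"
    using spherical_limit_stereo[OF assms(1,2) cont assms(4)] by blast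
  have "open (ball z d1 \<inter> (\<lambda>w. snd (stereo (g w))) -` {0<..})"
    by (intro continuous_open_preimage continuous_intros d1) auto
  moreover have "z \<in> ball z d1 \<inter> (\<lambda>w. snd (stereo (g w))) -` {0<..}"
    using d1(1) assms(5) by simp
  ultimately obtain d where d: "d > 0" "ball z d \<subseteq> ball z d1 \<inter> (\<lambda>w. snd (stereo (g w))) -` {0<..}"
    unfolding open_contains_ball by blast
  have dU: "ball z d \<subseteq> U" using d(2) d1(2) by blast
  have pos: "0 < snd (stereo (g w))" if "w \<in> ball z d" for w
    using d(2) that by force
  have ul: "uniform_limit (ball z d) (\<lambda>n w. stereo (Some (h n w))) (\<lambda>w. stereo (g w)) sequentially"
    using uniform_limit_on_subset[OF d1(3)] d(2) by blast
  \<comment> \<open>The limit read in the chart at infinity; on this ball heights are positive, so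
    the denominator is at least 1.\<close>
  define k where "k w = cnj (fst (stereo (g w))) / of_real (1 + snd (stereo (g w)))" for w
  have "uniform_limit (ball z d)
      (\<lambda>n w. cnj (fst (stereo (Some (h n w)))) / of_real (1 + snd (stereo (Some (h n w))))) k sequentially"
    unfolding k_def
  proof (rule uniform_lim_divide)
    show "bounded ((\<lambda>w. cnj (fst (stereo (g w)))) ` ball z d)"
      using cmod_fst_stereo_le by (auto simp: bounded_iff)
    show "1 \<le> norm (of_real (1 + snd (stereo (g w))) :: complex)" if "w \<in> ball z d" for w
      using pos[OF that] unfolding norm_of_real by linarith
  qed (auto intro!: uniform_limit_intros ul simp del: stereo.simps of_real_add)
  then have k: "uniform_limit (ball z d) (\<lambda>n w. inverse (h n w)) k sequentially"
    by (simp only: stereo_infinite_chart)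
  have "\<forall>\<^sub>F n in sequentially. \<forall>w\<in>ball z d. dist (stereo (Some (h n w))) (stereo (g w)) < 1"
    using uniform_limitD[OF ul, of 1] by simp
  then obtain N where N: "\<And>n w. n \<ge> N \<Longrightarrow> w \<in> ball z d \<Longrightarrow>
      dist (stereo (Some (h n w))) (stereo (g w)) < 1"
    unfolding eventually_sequentially by blast
  \<comment> \<open>A zero of \<open>h (n + N)\<close> goes to the south pole, of height -1. A point
    at chordal distance less than 1 from it has negative height, against \<open>pos\<close>. The
    shift by \<open>N\<close> drops the terms that may still have zeros.\<close>
  have nz: "h (n + N) w \<noteq> 0" if "w \<in> ball z d" for n w
  proof
    assume "h (n + N) w = 0"
    then have "snd (stereo (g w)) < 0"
      using N[of "n + N" w] that dist_snd_le[of "stereo (Some (h (n + N) w))" "stereo (g w)"]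
      by (simp add: dist_real_def)
    then show False using pos[OF that] by simp
  qed
  have hol: "(\<lambda>w. inverse (h (n + N) w)) holomorphic_on ball z d" for n
    using nz dU by (intro holomorphic_intros holomorphic_on_subset[OF assms(3)]) auto
  have kN: "uniform_limit (ball z d) (\<lambda>n w. inverse (h (n + N) w)) k sequentially"
    using filterlim_compose[OF k filterlim_add_const_nat_at_top[of N]] .
  have holk: "k holomorphic_on ball z d"
  proof (rule holomorphic_uniform_sequence[OF open_ball hol])
    fix x assume "x \<in> ball z d"
    then obtain r where "r > 0" "cball x r \<subseteq> ball z d"
      by (meson open_ball open_contains_cball)
    then show "\<exists>r. 0 < r \<and> cball x r \<subseteq> ball z d \<and>
        uniform_limit (cball x r) (\<lambda>n w. inverse (h (n + N) w)) k sequentially"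
      using uniform_limit_on_subset[OF kN] by blast
  qed
  have k0: "k z = 0" using assms(5) by (simp add: k_def)
  have "k constant_on ball z d"
  proof (rule ccontr)
    assume "\<not> k constant_on ball z d"
    then have "k z \<noteq> 0"
      using Hurwitz_no_zeros[OF open_ball _ hol holk uniform_limit_on_subset[OF kN]] nz d(1) by simp
    then show False using k0 by simp
  qed
  then have "k w = 0" if "w \<in> ball z d" for w
    using k0 that d(1) unfolding constant_on_def by force
  then have "fst (stereo (g w)) = 0" if "w \<in> ball z d" for w
    using that pos[OF that] unfolding k_def
    by (smt (verit) complex_cnj_zero_iff divide_eq_0_iff of_real_eq_0_iff)
  \<comment> \<open>The first coordinate vanishes only at the two poles of the sphere, and the
    positive height selects infinity.\<close>
  moreover have "p = None" if "fst (stereo p) = 0" "snd (stereo p) > 0" for p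
    using that by (cases p) auto
  ultimately have "g w = None" if "w \<in> ball z d" for w
    using pos that by blast
  then show thesis using that d(1) dU by blast
qed

section \<open>Uniform convergence of derivatives and Schwarzians\<close>

text \<open>Weierstrass' theorem: the Cauchy estimates for \<open>f n - g\<close> on discs of one
  fixed radius, centred in the smaller ball, bound the differences of the derivatives
  uniformly.\<close>

lemma uniform_limit_higher_deriv:
  assumes "r > 0" "r < R" "uniform_limit (ball z R) f g sequentially"
    and "\<And>n. f n holomorphic_on ball z R"
  shows "g holomorphic_on ball z R"
    and "uniform_limit (ball z r) (\<lambda>n. (deriv ^^ m) (f n)) ((deriv ^^ m) g) sequentially"
proof -
  show g: "g holomorphic_on ball z R"
  proof (rule holomorphic_uniform_sequence[OF open_ball assms(4)])
    fix x assume "x \<in> ball z R"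
    then obtain r where "r > 0" "cball x r \<subseteq> ball z R"
      by (meson open_ball open_contains_cball)
    then show "\<exists>r. 0 < r \<and> cball x r \<subseteq> ball z R \<and> uniform_limit (cball x r) f g sequentially"
      using uniform_limit_on_subset[OF assms(3)] by blast
  qed
  \<comment> \<open>Half the gap between the radii: a disc of radius \<open>s\<close> centred in
    \<open>ball z r\<close> stays within distance (R + r)/2 < R of \<open>z\<close>.\<close>
  define s where "s = (R - r) / 2"
  have s: "s > 0" using assms(2) by (simp add: s_def)
  show "uniform_limit (ball z r) (\<lambda>n. (deriv ^^ m) (f n)) ((deriv ^^ m) g) sequentially"
  proof (rule uniform_limitI)
    fix e :: real assume "e > 0"
    \<comment> \<open>Chosen so that the Cauchy bound \<open>fact m * c / s ^ m\<close> equals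
      e/2.\<close>
    define c where "c = e * s ^ m / (2 * fact m)"
    have c: "c > 0" using \<open>e > 0\<close> s by (simp add: c_def)
    show "\<forall>\<^sub>F n in sequentially. \<forall>w\<in>ball z r. dist ((deriv ^^ m) (f n) w) ((deriv ^^ m) g w) < e"
      using uniform_limitD[OF assms(3) c]
    proof eventually_elim
      case (elim n)
      show ?case
      proof
        fix w assume w: "w \<in> ball z r"
        have sub: "cball w s \<subseteq> ball z R"
        proof
          fix x assume "x \<in> cball w s"
          then show "x \<in> ball z R"
            using w dist_triangle[of z x w] assms(2) by (simp add: s_def field_simps)
        qed
        have hol: "(\<lambda>x. f n x - g x) holomorphic_on ball z R"
          by (intro holomorphic_intros assms(4) g)
        have "norm ((deriv ^^ m) (\<lambda>x. f n x - g x) w) \<le> fact m * c / s ^ m"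
        \<comment> \<open>The Cauchy bound is applied for positive order only; for order 0 the
          estimate is the uniform closeness itself.\<close>
        proof (cases "m = 0")
          case True
          then show ?thesis using elim[rule_format, of w] w assms(2) by (auto simp: dist_norm)
        next
          case False
          show ?thesis
          proof (rule Cauchy_higher_deriv_bound[where y = 0])
            show "(\<lambda>x. f n x - g x) holomorphic_on ball w s"
              using holomorphic_on_subset[OF hol] sub by (meson ball_subset_cball order_trans)
            show "continuous_on (cball w s) (\<lambda>x. f n x - g x)"
              using holomorphic_on_imp_continuous_on[OF hol] sub continuous_on_subset by blast
            show "f n x - g x \<in> ball 0 c" if "x \<in> ball w s" for x
            proof -
              have "x \<in> ball z R" using that sub ball_subset_cball by blast
              then show ?thesis using elim by (simp add: dist_norm norm_minus_commute)
            qed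
          qed (use s False in auto)
        qed
        also have "\<dots> < e" using \<open>e > 0\<close> s by (simp add: c_def)
        finally show "dist ((deriv ^^ m) (f n) w) ((deriv ^^ m) g w) < e"
          using higher_deriv_diff[OF assms(4)[of n] g open_ball, of w m] w assms(2)
          by (simp add: dist_norm)
      qed
    qed
  qed
qed

text \<open>The bound \<open>e\<close> on the first derivatives passes to the limit, so quotients by
  them converge uniformly. Quotients and products of uniform limits also need bounded limits, which
  is why the radius is halved.\<close>

lemma uniform_limit_schwarzian:
  assumes "R > 0" "uniform_limit (ball z R) f g sequentially"
    and "\<And>n. f n holomorphic_on ball z R"
    and "e > 0" "\<And>n w. w \<in> ball z R \<Longrightarrow> cmod (deriv (f n) w) \<ge> e"
  shows "uniform_limit (ball z (R / 2)) (\<lambda>n. schwarzian (f n)) (schwarzian g) sequentially"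
proof -
  have R: "R / 2 > 0" "R / 2 < R" using assms(1) by auto
  note ulim = uniform_limit_higher_deriv[OF R assms(2,3)]
  \<comment> \<open>The closed half ball is a compact subset of \<open>ball z R\<close>, on which
    the derivatives of \<open>g\<close> are continuous.\<close>
  have bdd: "bounded ((deriv ^^ m) g ` ball z (R / 2))" for m
  proof -
    have "(deriv ^^ m) g holomorphic_on ball z R"
      by (intro holomorphic_higher_deriv ulim(1) open_ball)
    then have "continuous_on (cball z (R / 2)) ((deriv ^^ m) g)"
      by (rule continuous_on_subset[OF holomorphic_on_imp_continuous_on]) (use R(2) in auto)
    then have "bounded ((deriv ^^ m) g ` cball z (R / 2))"
      by (intro compact_imp_bounded compact_continuous_image) auto
    then show ?thesis by (rule bounded_subset) auto
  qed
  have lim1: "uniform_limit (ball z (R / 2)) (\<lambda>n. deriv (f n)) (deriv g) sequentially"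
    using ulim(2)[of 1] by simp
  have lower: "e \<le> cmod (deriv g w)" if "w \<in> ball z (R / 2)" for w
  proof (rule tendsto_lowerbound)
    show "(\<lambda>n. cmod (deriv (f n) w)) \<longlonglongrightarrow> cmod (deriv g w)"
      by (intro tendsto_norm tendsto_uniform_limitI[OF lim1 that])
  qed (use assms(1,5) that in \<open>auto intro!: always_eventually\<close>)
  have quot: "uniform_limit (ball z (R / 2)) (\<lambda>n w. (deriv ^^ m) (f n) w / deriv (f n) w)
      (\<lambda>w. (deriv ^^ m) g w / deriv g w) sequentially" for m
    using uniform_lim_divide[OF ulim(2) lim1 bdd lower assms(4)] .
  have bddq: "bounded ((\<lambda>w. (deriv ^^ 2) g w / deriv g w) ` ball z (R / 2))"
  proof -
    obtain B where B: "\<And>w. w \<in> ball z (R / 2) \<Longrightarrow> cmod ((deriv ^^ 2) g w) \<le> B"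
      using bdd[of 2] unfolding bounded_iff by blast
    have "cmod ((deriv ^^ 2) g w / deriv g w) \<le> B / e" if "w \<in> ball z (R / 2)" for w
      unfolding norm_divide
      using B[OF that] lower[OF that] assms(4) by (intro frac_le) (auto intro: order_trans[OF norm_ge_zero])
    then show ?thesis unfolding bounded_iff by blast
  qed
  show ?thesis
    unfolding schwarzian_def[abs_def] power2_eq_square
    by (intro uniform_limit_minus quot bounded_linear.uniform_limit[OF bounded_linear_mult_right]
        uniform_lim_mult bddq)
qed

section \<open>Return from the plane to the sphere\<close>

text \<open>The squared chordal distance is 4|z - w|^2 / ((1 + |z|^2)(1 + |w|^2)), and both factors
  of the denominator are at least 1.\<close>

lemma dist_stereo_Some_le: "dist (stereo (Some z)) (stereo (Some w)) \<le> 2 * dist z w"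
proof (rule power2_le_imp_le)
  define a b where "a = 1 + (cmod z)\<^sup>2" and "b = 1 + (cmod w)\<^sup>2"
  have ab: "a \<ge> 1" "b \<ge> 1" by (auto simp: a_def b_def)
  have d: "(dist z w)\<^sup>2 = (a - 1) + (b - 1) - 2 * (z \<bullet> w)"
    by (simp add: a_def b_def dist_norm power2_norm_eq_inner inner_diff inner_commute)
  have "stereo (Some z) \<bullet> stereo (Some w) = 2 / a * (2 / b * (z \<bullet> w)) + (a - 2) / a * ((b - 2) / b)"
    by (simp add: a_def b_def)
  also have "\<dots> = (4 * (z \<bullet> w) + (a - 2) * (b - 2)) / (a * b)"
    by (simp add: add_divide_distrib)
  finally have "(dist (stereo (Some z)) (stereo (Some w)))\<^sup>2 = 4 * (dist z w)\<^sup>2 / (a * b)"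
    using ab unfolding dist_stereo_power2 d by (simp add: field_simps del: stereo.simps)
  also have "\<dots> \<le> 4 * (dist z w)\<^sup>2 / 1"
    using ab mult_mono[of 1 a 1 b] by (intro divide_left_mono) auto
  finally show "(dist (stereo (Some z)) (stereo (Some w)))\<^sup>2 \<le> (2 * dist z w)\<^sup>2"
    by (simp add: power_mult_distrib)
qed simp

lemma uniform_limit_stereo:
  assumes "uniform_limit S f g F"
  shows "uniform_limit S (\<lambda>n w. stereo (Some (f n w))) (\<lambda>w. stereo (Some (g w))) F"
proof (rule uniform_limitI)
  fix e :: real assume "e > 0"
  then have "\<forall>\<^sub>F n in F. \<forall>w\<in>S. dist (f n w) (g w) < e / 2"
    using uniform_limitD[OF assms, of "e / 2"] by simp
  then show "\<forall>\<^sub>F n in F. \<forall>w\<in>S. dist (stereo (Some (f n w))) (stereo (Some (g w))) < e"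
  proof eventually_elim
    case (elim n)
    show ?case
    proof
      fix w assume "w \<in> S"
      then show "dist (stereo (Some (f n w))) (stereo (Some (g w))) < e"
        using elim dist_stereo_Some_le[of "f n w" "g w"] by fastforce
    qed
  qed
qed

text \<open>Only the first derivative occurs in denominators. This lets \<open>to_sphere\<close> of
  a Schwarzian be replaced by its ordinary value.\<close>

lemma analytic_on_schwarzian:
  assumes "f analytic_on {z}" "deriv f z \<noteq> 0"
  shows "schwarzian f analytic_on {z}"
proof -
  have "(\<lambda>w. (deriv ^^ m) f w / deriv f w) analytic_on {z}" for m
    by (rule analytic_on_divide[OF analytic_higher_deriv analytic_deriv]) (use assms in auto)
  then show ?thesis
    unfolding schwarzian_def[abs_def]
    by (rule analytic_on_diff[OF _ analytic_on_mult[OF analytic_on_const analytic_on_power]]) fact+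
qed

section \<open>Normality of the Schwarzians on \<open>D\<close>\<close>

theorem theorem2p11:
  fixes F :: "(complex \<Rightarrow> complex) set" and D :: "complex set"
    and \<zeta> :: complex and L \<epsilon> :: real
  assumes "\<And>f. f \<in> F \<Longrightarrow> f analytic_on UNIV"
    and "D = domain_of_normality F" and "connected D"
    and "\<zeta> \<in> D" and "\<And>f. f \<in> F \<Longrightarrow> cmod (f \<zeta>) \<le> L"
    and "\<epsilon> > 0" and "\<And>f z. f \<in> F \<Longrightarrow> z \<in> D \<Longrightarrow> cmod (deriv f z) \<ge> \<epsilon>"
  shows "D \<subseteq> domain_of_normality (schwarzian ` F)"
proof -
  note entire = assms(1) and D = assms(2) and deriv_ge = assms(7)
  have openD: "open D" and normalD: "normal_family_on F D"
    using domain_of_normality_greatest(1,2)[of F] by (auto simp: D)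
  have "normal_family_on (schwarzian ` F) D"
    unfolding normal_family_on_def
  proof (intro allI impI)
    fix s :: "nat \<Rightarrow> complex \<Rightarrow> complex" assume "\<forall>n. s n \<in> schwarzian ` F"
    \<comment> \<open>Choosing a preimage in \<open>F\<close> for each term allows the subsequence
      to be extracted by normality of \<open>F\<close>.\<close>
    then have "\<exists>f. \<forall>n. f n \<in> F \<and> s n = schwarzian (f n)" by (intro choice) auto
    then obtain f where f: "\<And>n. f n \<in> F" "\<And>n. s n = schwarzian (f n)" by blast
    obtain r g where r: "strict_mono r"
      and lim: "spherical_loc_uniform_limit D (\<lambda>n. to_sphere (f (r n))) g"
      using normalD f(1) unfolding normal_family_on_def by blast
    define h where "h n = f (r n)" for n
    have an: "h n analytic_on {z}" for n z
      using analytic_on_subset[OF entire[OF f(1)]] by (simp add: h_def)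
    have hol: "h n holomorphic_on S" for n S
      using entire[OF f(1)] analytic_imp_holomorphic holomorphic_on_subset
      unfolding h_def by blast
    have lim: "spherical_loc_uniform_limit D (\<lambda>n w. Some (h n w)) g"
    proof -
      have "to_sphere (f (r n)) = (\<lambda>w. Some (h n w))" for n
        using to_sphere_analytic[OF an] by (auto simp: h_def)
      then show ?thesis using lim by simp
    qed
    have cont: "continuous_on D (h n)" for n
      by (rule holomorphic_on_imp_continuous_on[OF hol])
    define A where "A = {z \<in> D. g z = None}"
    have "open A"
      unfolding open_contains_ball
    proof
      fix z assume "z \<in> A"
      then have z: "z \<in> D" "g z = None" by (auto simp: A_def)
      obtain d where "d > 0" "ball z d \<subseteq> D" "\<And>w. w \<in> ball z d \<Longrightarrow> g w = None"
        by (rule spherical_limit_infinite[OF openD lim hol z]) (rule that)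
      then show "\<exists>d>0. ball z d \<subseteq> A" unfolding A_def by blast
    qed
    moreover have "open (D - A)"
      unfolding open_contains_ball
    proof
      fix z assume "z \<in> D - A"
      then have z: "z \<in> D" "g z \<noteq> None" by (auto simp: A_def)
      obtain d where "d > 0" "ball z d \<subseteq> D" "\<And>w. w \<in> ball z d \<Longrightarrow> g w \<noteq> None"
        "uniform_limit (ball z d) h (\<lambda>w. the (g w)) sequentially"
        by (rule spherical_limit_finite[OF openD lim cont z]) (rule that)
      then show "\<exists>d>0. ball z d \<subseteq> D - A" unfolding A_def by blast
    qed
    \<comment> \<open>The bound \<open>L\<close> keeps the heights at \<open>\<zeta>\<close> below 1
      - 2/(1 + L^2), so their limit cannot be the height 1 of infinity.\<close>
    moreover have "\<zeta> \<notin> A"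
    proof
      assume "\<zeta> \<in> A"
      have "(\<lambda>n. snd (stereo (Some (h n \<zeta>)))) \<longlonglongrightarrow> snd (stereo (g \<zeta>))"
        by (intro tendsto_snd spherical_limit_pointwise[OF lim assms(4)])
      moreover have "snd (stereo (Some (h n \<zeta>))) \<le> 1 - 2 / (1 + L\<^sup>2)" for n
      proof -
        have "(cmod (h n \<zeta>))\<^sup>2 \<le> L\<^sup>2"
          using assms(5)[OF f(1)] by (intro power_mono) (auto simp: h_def)
        then have "2 / (1 + L\<^sup>2) \<le> 2 / (1 + (cmod (h n \<zeta>))\<^sup>2)"
          by (intro divide_left_mono mult_pos_pos add_pos_nonneg) auto
        then show ?thesis using one_minus_snd_stereo_Some[of "h n \<zeta>"] by linarith
      qed
      ultimately have "snd (stereo (g \<zeta>)) \<le> 1 - 2 / (1 + L\<^sup>2)"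
        by (intro tendsto_upperbound[where F = sequentially]) (auto intro!: always_eventually)
      moreover have "2 / (1 + L\<^sup>2) > 0" by (intro divide_pos_pos add_pos_nonneg) auto
      ultimately show False using \<open>\<zeta> \<in> A\<close> by (simp add: A_def)
    qed
    \<comment> \<open>Connectedness of \<open>D\<close> enters here: \<open>A\<close> and
      \<open>D - A\<close> are disjoint open sets covering \<open>D\<close>, and
      \<open>\<zeta>\<close> lies in the second.\<close>
    ultimately have "A = {}"
      using connectedD[OF assms(3), of A "D - A"] assms(4) by (auto simp: A_def)
    then have fin: "g z \<noteq> None" if "z \<in> D" for z using that by (auto simp: A_def)
    \<comment> \<open>By \<open>fin\<close>, \<open>the (g w)\<close> is a genuine value throughout
      \<open>D\<close>, namely the Euclidean limit of \<open>h n w\<close>; the Schwarzians tend to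
      its Schwarzian.\<close>
    have "spherical_loc_uniform_limit D (\<lambda>n. to_sphere (schwarzian (h n)))
        (\<lambda>w. Some (schwarzian (\<lambda>w. the (g w)) w))"
      unfolding spherical_loc_uniform_limit_iff
    proof
      fix z assume "z \<in> D"
      obtain R where R: "R > 0" "ball z R \<subseteq> D" "\<And>w. w \<in> ball z R \<Longrightarrow> g w \<noteq> None"
        "uniform_limit (ball z R) h (\<lambda>w. the (g w)) sequentially"
        by (rule spherical_limit_finite[OF openD lim cont \<open>z \<in> D\<close> fin[OF \<open>z \<in> D\<close>]])
          (rule that)
      have "uniform_limit (ball z (R / 2)) (\<lambda>n. schwarzian (h n))
          (schwarzian (\<lambda>w. the (g w))) sequentially"
        using R(2) deriv_ge[OF f(1)]
        by (intro uniform_limit_schwarzian[OF R(1,4) hol assms(6)]) (auto simp: h_def)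
      then have "uniform_limit (ball z (R / 2)) (\<lambda>n w. stereo (Some (schwarzian (h n) w)))
          (\<lambda>w. stereo (Some (schwarzian (\<lambda>w. the (g w)) w))) sequentially"
        by (rule uniform_limit_stereo)
      then have *: "uniform_limit (ball z (R / 2) \<inter> D) (\<lambda>n w. stereo (Some (schwarzian (h n) w)))
          (\<lambda>w. stereo (Some (schwarzian (\<lambda>w. the (g w)) w))) sequentially"
        by (rule uniform_limit_on_subset) auto
      \<comment> \<open>The lower bound on the first derivative rules out poles of the Schwarzians
        in \<open>D\<close>.\<close>
      have sph: "to_sphere (schwarzian (h n)) w = Some (schwarzian (h n) w)" if "w \<in> D" for n w
      proof -
        have "deriv (h n) w \<noteq> 0"
          using deriv_ge[OF f(1) that, of "r n"] assms(6) by (auto simp: h_def)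
        then show ?thesis by (intro to_sphere_analytic analytic_on_schwarzian an)
      qed
      have "uniform_limit (ball z (R / 2) \<inter> D) (\<lambda>n w. stereo (to_sphere (schwarzian (h n)) w))
          (\<lambda>w. stereo (Some (schwarzian (\<lambda>w. the (g w)) w))) sequentially"
        using * by (rule uniform_limit_cong'[THEN iffD1, rotated -1])
          (simp_all add: sph del: stereo.simps)
      then show "\<exists>d>0. uniform_limit (ball z d \<inter> D) (\<lambda>n w. stereo (to_sphere (schwarzian (h n)) w))
          (\<lambda>w. stereo (Some (schwarzian (\<lambda>w. the (g w)) w))) sequentially"
        using R(1) half_gt_zero by blast
    qed
    then show "\<exists>r g. strict_mono r \<and> spherical_loc_uniform_limit D (\<lambda>n. to_sphere (s (r n))) g"
      using r unfolding f(2) h_def by blast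
  qed
  then show ?thesis by (rule domain_of_normality_greatest(3)[OF openD])
qed

end
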